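(* Let $X$ be a Kähler manifold and let $\alpha=\sum_{k\ge1}\hbar^k\omega_k$ be a closed formal $2$-form on $X$. The solution $I\in\mathcal{A}^1_X(\mathcal{W}_{X,\mathbb{C}})$ of the Fedosov equation $$\nabla I-\delta I+\frac1\hbar I\star I+R_\nabla=\alpha$$ satisfying the two conditions $$(\delta^{1,0})^{-1}(I)=0,\qquad \pi_{0,*}(I)=0$$ is unique (i.e. there is at most one such solution).
   Context: **Kähler conventions.** Summation convention. $\omega=\omega_{\alpha\bar\beta}dz^\alpha\wedge d\bar z^\beta=\sqrt{-1}g_{\alpha\bar\beta}dz^\alpha\wedge d\bar z^\beta$ is the Kähler form, $\omega^{\bar\gamma\alpha}\omega_{\alpha\bar\beta}=\delta^{\bar\gamma}_{\bar\beta}$, $\omega^{\alpha\bar\beta}=-\omega^{\bar\beta\alpha}$. **Weyl bundle.** $\overline{\mathcal{W}}_X=\widehat{\mathrm{Sym}}(\overline{T^*X})[[\hbar]]$ and $\mathcal{W}_{X,\mathbb{C}}=\widehat{\mathrm{Sym}}(T^*X)[[\hbar]]\otimes\overline{\mathcal{W}}_X$; local sections are formal power series in $\hbar$, $y^i$ (frame of the holomorphic cotangent bundle) and $\bar y^j$ (frame of the anti-holomorphic cotangent bundle). $\delta=dz^i\wedge\partial_{y^i}+d\bar z^j\wedge\partial_{\bar y^j}$. $(\delta^{1,0})^{-1}a=\frac{1}{p_1+p_2}y^k\iota_{\partial_{z^k}}a$ if $a$ has form type $(p_1,q_1)$ and degree $p_2$ in the $y$'s (zero if $p_1+p_2=0$).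 $\pi_{0,*}:\mathcal{A}_X^\bullet(\mathcal{W}_{X,\mathbb{C}})\to\mathcal{A}_X^{0,\bullet}(\overline{\mathcal{W}}_X)$ is the natural projection (keeping exactly the terms containing no $dz^i$ and no $y^i$). Wick product: $a\star b=\sum_k\frac{\hbar^k}{k!}\omega^{i_1\bar j_1}\cdots\omega^{i_k\bar j_k}\partial_{y^{i_1}}\cdots\partial_{y^{i_k}}a\;\partial_{\bar y^{j_1}}\cdots\partial_{\bar y^{j_k}}b$, with form parts wedged. $\nabla$ is the Levi-Civita connection; $\nabla^2(y^m)=R_{i\bar jk}^mdz^i\wedge d\bar z^j\otimes y^k$, $R_{i\bar jk\bar l}=R_{i\bar jk}^mg_{m\bar l}$, $R_\nabla=\sqrt{-1}R_{i\bar jk\bar l}dz^i\wedge d\bar z^j\otimes y^k\bar y^l$. *)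

theory Defs
  imports "HOL-Analysis.Analysis"
begin

section \<open>Calculus on open subsets of complex coordinate space\<close>

text \<open>An index of the complexified (co)tangent frame: \<open>Inl i\<close> stands for the holomorphic direction
  \<open>z\<^sup>i\<close>, and \<open>Inr j\<close> for the anti-holomorphic direction \<open>\<bar>z\<^sup>j\<close>.\<close>

type_synonym 'n idx = "'n + 'n"

fun coord :: "'n idx \<Rightarrow> complex ^ 'n \<Rightarrow> complex" where
  "coord (Inl i) z = z $ i"
| "coord (Inr j) z = cnj (z $ j)"

text \<open>The Wirtinger derivatives \<open>\<partial>/\<partial>z\<^sup>i = (\<partial>\<^sub>x - \<i>\<partial>\<^sub>y)/2\<close> and
  \<open>\<partial>/\<partial>\<bar>z\<^sup>j = (\<partial>\<^sub>x + \<i>\<partial>\<^sub>y)/2\<close>; the Frechet derivative is the real one.\<close>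

fun pdiff :: "'n::finite idx \<Rightarrow> (complex ^ 'n \<Rightarrow> complex) \<Rightarrow> complex ^ 'n \<Rightarrow> complex" where
  "pdiff (Inl i) f z =
     (frechet_derivative f (at z) (axis i 1) - \<i> * frechet_derivative f (at z) (axis i \<i>)) / 2"
| "pdiff (Inr j) f z =
     (frechet_derivative f (at z) (axis j 1) + \<i> * frechet_derivative f (at z) (axis j \<i>)) / 2"

primrec Ck_on :: "nat \<Rightarrow> (complex ^ 'n::finite) set \<Rightarrow> (complex ^ 'n \<Rightarrow> complex) \<Rightarrow> bool" where
  "Ck_on 0 S f \<longleftrightarrow> continuous_on S f"
| "Ck_on (Suc k) S f \<longleftrightarrow> (\<forall>z\<in>S. f differentiable at z) \<and>
     (\<forall>v. Ck_on k S (\<lambda>z. frechet_derivative f (at z) v))"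

definition smooth_on :: "(complex ^ 'n::finite) set \<Rightarrow> (complex ^ 'n \<Rightarrow> complex) \<Rightarrow> bool" where
  "smooth_on S f \<longleftrightarrow> (\<forall>k. Ck_on k S f)"

definition holomorphic_map_on ::
  "(complex ^ 'n::finite) set \<Rightarrow> (complex ^ 'n \<Rightarrow> complex ^ 'n) \<Rightarrow> bool" where
  "holomorphic_map_on S F \<longleftrightarrow>
     (\<forall>z\<in>S. \<exists>D. (F has_derivative D) (at z) \<and> (\<forall>c v. D (c *s v) = c *s D v))"


section \<open>Complex manifolds\<close>

type_synonym ('a, 'n) chart = "'a set \<times> ('a \<Rightarrow> complex ^ 'n)"

definition chart_image :: "('a, 'n) chart \<Rightarrow> (complex ^ 'n) set" where
  "chart_image c = snd c ` fst c"

definition overlap :: "('a, 'n) chart \<Rightarrow> ('a, 'n) chart \<Rightarrow> (complex ^ 'n) set" where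
  "overlap c c' = snd c ` (fst c \<inter> fst c')"

definition transition :: "('a, 'n) chart \<Rightarrow> ('a, 'n) chart \<Rightarrow> complex ^ 'n \<Rightarrow> complex ^ 'n" where
  "transition c c' = snd c' \<circ> inv_into (fst c) (snd c)"

definition is_chart :: "'a topology \<Rightarrow> ('a, 'n::finite) chart \<Rightarrow> bool" where
  "is_chart X c \<longleftrightarrow> openin X (fst c) \<and> open (chart_image c) \<and>
     homeomorphic_map (subtopology X (fst c)) (top_of_set (chart_image c)) (snd c)"

definition complex_manifold :: "'a topology \<Rightarrow> ('a, 'n::finite) chart set \<Rightarrow> bool" where
  "complex_manifold X A \<longleftrightarrow>
     Hausdorff_space X \<and> second_countable X \<and>
     (\<forall>c\<in>A. is_chart X c) \<and> (\<Union>c\<in>A. fst c) = topspace X \<and>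
     (\<forall>c\<in>A. \<forall>c'\<in>A. holomorphic_map_on (overlap c c') (transition c c'))"


section \<open>Differential forms with values in the Weyl bundle\<close>

text \<open>Forms and Weyl elements are given by their components in the coordinate frames.

  A differential form \<open>a\<close> is encoded by its values \<open>a(\<partial>\<^bsub>L\<^sub>1\<^esub>, \<dots>, \<partial>\<^bsub>L\<^sub>p\<^esub>)\<close> on lists \<open>L\<close> of frame
  vectors, so that \<open>dx\<^sup>P \<and> dx\<^sup>Q\<close> has the value \<open>1\<close> on \<open>[P, Q]\<close> and \<open>-1\<close> on \<open>[Q, P]\<close> if \<open>P \<noteq> Q\<close>.

  A formal power series in the \<open>y\<^sup>i\<close> and \<open>\<bar>y\<^sup>j\<close> (here \<open>y\<^sup>P\<close> with \<open>P = Inl i\<close> and \<open>P = Inr j\<close>) is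
  encoded by its Taylor coefficients \<open>M \<mapsto> (\<partial>\<^bsub>y, M\<^sub>1\<^esub> \<cdots> \<partial>\<^bsub>y, M\<^sub>r\<^esub> a)(0)\<close>, which are symmetric
  in the list \<open>M\<close>: the series is \<open>\<Sum>\<^sub>r 1/r! \<Sum> a(M) y\<^bsup>M\<^sub>1\<^esup> \<cdots> y\<^bsup>M\<^sub>r\<^esup>\<close>, the inner sum being over all
  lists \<open>M\<close> of length \<open>r\<close>. These are the components of a section of \<open>Sym\<^sup>r(T\<^sup>*X \<oplus> \<bar>T\<^sup>*X)\<close>.

  A local Weyl form thus takes a point, the exponent of \<open>\<hbar>\<close>, \<open>L\<close> and \<open>M\<close>. A global form consists
  of a local form in every chart of the atlas. It is set to zero outside the charts, so that equality
  of forms is equality of functions.\<close>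

type_synonym 'n lform = "complex ^ 'n \<Rightarrow> 'n idx list \<Rightarrow> complex"
type_synonym 'n lsym = "complex ^ 'n \<Rightarrow> 'n idx list \<Rightarrow> 'n idx list \<Rightarrow> complex"
type_synonym 'n lweyl = "complex ^ 'n \<Rightarrow> nat \<Rightarrow> 'n idx list \<Rightarrow> 'n idx list \<Rightarrow> complex"

type_synonym ('a, 'n) form = "('a, 'n) chart \<Rightarrow> 'n lform"
type_synonym ('a, 'n) sym = "('a, 'n) chart \<Rightarrow> 'n lsym"
type_synonym ('a, 'n) weyl = "('a, 'n) chart \<Rightarrow> 'n lweyl"

definition alternating :: "('i list \<Rightarrow> complex) \<Rightarrow> bool" where
  "alternating f \<longleftrightarrow>
     (\<forall>L i j. i < j \<and> j < length L \<longrightarrow> f (L[i := L ! j, j := L ! i]) = - f L)"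

definition symmetric :: "('i list \<Rightarrow> complex) \<Rightarrow> bool" where
  "symmetric f \<longleftrightarrow> (\<forall>M M'. mset M = mset M' \<longrightarrow> f M = f M')"

text \<open>The Jacobian of \<open>F\<close> in the complexified frames; \<open>tensor_pull F z\<close> is the transformation of
  covariant tensor components under the coordinate change \<open>F\<close>.\<close>

definition jac :: "(complex ^ 'n \<Rightarrow> complex ^ 'n) \<Rightarrow> complex ^ 'n \<Rightarrow> 'n idx \<Rightarrow> 'n::finite idx \<Rightarrow> complex" where
  "jac F z P Q = pdiff Q (\<lambda>z. coord P (F z)) z"

definition tensor_pull ::
  "(complex ^ 'n \<Rightarrow> complex ^ 'n) \<Rightarrow> complex ^ 'n \<Rightarrow> ('n idx list \<Rightarrow> complex) \<Rightarrow> 'n::finite idx list \<Rightarrow> complex"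
  where "tensor_pull F z t L =
    (\<Sum>K | length K = length L. (\<Prod>s<length L. jac F z (K ! s) (L ! s)) * t K)"

text \<open>The space of \<open>p\<close>-forms with values in the completed symmetric algebra of the complexified
  cotangent bundle.\<close>

definition sym_forms :: "('a, 'n::finite) chart set \<Rightarrow> nat \<Rightarrow> ('a, 'n) sym set" where
  "sym_forms A p = {a.
     (\<forall>c z L M. c \<notin> A \<or> z \<notin> chart_image c \<or> length L \<noteq> p \<longrightarrow> a c z L M = 0) \<and>
     (\<forall>c\<in>A. \<forall>L M. smooth_on (chart_image c) (\<lambda>z. a c z L M)) \<and>
     (\<forall>c\<in>A. \<forall>z\<in>chart_image c.
        (\<forall>M. alternating (\<lambda>L. a c z L M)) \<and> (\<forall>L. symmetric (a c z L))) \<and>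
     (\<forall>c\<in>A. \<forall>c'\<in>A. \<forall>z\<in>overlap c c'. \<forall>L M.
        a c z L M =
          tensor_pull (transition c c') z
            (\<lambda>K. tensor_pull (transition c c') z (\<lambda>N. a c' (transition c c' z) K N) M) L)}"

definition weyl_forms :: "('a, 'n::finite) chart set \<Rightarrow> nat \<Rightarrow> ('a, 'n) weyl set" where
  "weyl_forms A p = {a. \<forall>h. (\<lambda>c z L M. a c z h L M) \<in> sym_forms A p}"

definition diff_forms :: "('a, 'n::finite) chart set \<Rightarrow> nat \<Rightarrow> ('a, 'n) form set" where
  "diff_forms A p = {f. (\<lambda>c z L M. if M = [] then f c z L else 0) \<in> sym_forms A p}"

definition omit :: "nat \<Rightarrow> 'i list \<Rightarrow> 'i list" where
  "omit s L = take s L @ drop (Suc s) L"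

definition ext_d :: "'n lform \<Rightarrow> 'n::finite lform" where
  "ext_d f z L = (\<Sum>s<length L. (-1) ^ s * pdiff (L ! s) (\<lambda>z. f z (omit s L)) z)"

definition closed_form :: "('a, 'n::finite) chart set \<Rightarrow> ('a, 'n) form \<Rightarrow> bool" where
  "closed_form A f \<longleftrightarrow> (\<forall>c\<in>A. \<forall>z\<in>chart_image c. \<forall>L. ext_d (f c) z L = 0)"

text \<open>The formal 2-form \<open>\<Sum>\<^bsub>k\<ge>1\<^esub> \<hbar>\<^sup>k \<omega>\<^sub>k\<close> with \<open>\<omega>\<^sub>k = w k\<close>, as a Weyl form; \<open>w 0\<close> is not used.\<close>

definition formal_form :: "(nat \<Rightarrow> ('a, 'n) form) \<Rightarrow> ('a, 'n) weyl" where
  "formal_form w c z h L M = (if 1 \<le> h \<and> M = [] then w h c z L else 0)"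


section \<open>Kaehler manifolds and the Levi-Civita connection\<close>

text \<open>\<open>herm \<omega> z a b\<close> is \<open>g\<^bsub>a\<bar>b\<^esub>\<close>, where \<open>\<omega> = \<i> g\<^bsub>a\<bar>b\<^esub> dz\<^sup>a \<and> d\<bar>z\<^sup>b\<close>.\<close>

definition herm :: "'n lform \<Rightarrow> complex ^ 'n \<Rightarrow> 'n \<Rightarrow> 'n \<Rightarrow> complex" where
  "herm \<omega> z a b = - \<i> * \<omega> z [Inl a, Inr b]"

definition kaehler_manifold ::
  "'a topology \<Rightarrow> ('a, 'n::finite) chart set \<Rightarrow> ('a, 'n) form \<Rightarrow> bool" where
  "kaehler_manifold X A \<omega> \<longleftrightarrow>
     complex_manifold X A \<and> \<omega> \<in> diff_forms A 2 \<and> closed_form A \<omega> \<and>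
     (\<forall>c\<in>A. \<forall>z\<in>chart_image c.
        (\<forall>a b. \<omega> c z [Inl a, Inl b] = 0 \<and> \<omega> c z [Inr a, Inr b] = 0) \<and>
        (\<forall>a b. herm (\<omega> c) z b a = cnj (herm (\<omega> c) z a b)) \<and>
        (\<forall>v. v \<noteq> 0 \<longrightarrow> 0 < Re (\<Sum>a\<in>UNIV. \<Sum>b\<in>UNIV. herm (\<omega> c) z a b * v $ a * cnj (v $ b))))"

text \<open>\<open>omega_inv \<omega> z i j\<close> is \<open>\<omega>\<^bsup>i\<bar>j\<^esup> = - \<omega>\<^bsup>\<bar>j i\<^esup>\<close>, where the matrix \<open>\<omega>\<^bsup>\<bar>j i\<^esup>\<close> (row \<open>j\<close>, column \<open>i\<close>)
  is the inverse of \<open>\<omega>\<^bsub>a\<bar>b\<^esub>\<close>.\<close>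

definition omega_inv :: "'n::finite lform \<Rightarrow> complex ^ 'n \<Rightarrow> 'n \<Rightarrow> 'n \<Rightarrow> complex" where
  "omega_inv \<omega> z i j = - (matrix_inv (\<chi> a b. \<omega> z [Inl a, Inr b]) $ j $ i)"

text \<open>The complex bilinear extension of the Riemannian metric to the complexified tangent bundle, and
  the Christoffel symbols \<open>christoffel \<omega> z C P Q = \<Gamma>\<^sup>C\<^bsub>PQ\<^esub>\<close> of its Levi-Civita connection in the
  complexified frame.\<close>

fun metric :: "'n lform \<Rightarrow> complex ^ 'n \<Rightarrow> 'n idx \<Rightarrow> 'n idx \<Rightarrow> complex" where
  "metric \<omega> z (Inl a) (Inr b) = herm \<omega> z a b"
| "metric \<omega> z (Inr b) (Inl a) = herm \<omega> z a b"
| "metric \<omega> z (Inl a) (Inl b) = 0"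
| "metric \<omega> z (Inr a) (Inr b) = 0"

definition christoffel ::
  "'n::finite lform \<Rightarrow> complex ^ 'n \<Rightarrow> 'n idx \<Rightarrow> 'n idx \<Rightarrow> 'n idx \<Rightarrow> complex" where
  "christoffel \<omega> z C P Q =
     (\<Sum>D\<in>UNIV. matrix_inv (\<chi> E F. metric \<omega> z E F) $ C $ D *
        (pdiff P (\<lambda>z. metric \<omega> z Q D) z + pdiff Q (\<lambda>z. metric \<omega> z P D) z
          - pdiff D (\<lambda>z. metric \<omega> z P Q) z)) / 2"

text \<open>The exterior covariant derivative on Weyl forms. In particular
  \<open>\<nabla>y\<^sup>C = - \<Gamma>\<^sup>C\<^bsub>PQ\<^esub> dx\<^sup>P \<otimes> y\<^sup>Q\<close>.\<close>

definition nabla :: "'n lform \<Rightarrow> 'n lweyl \<Rightarrow> 'n::finite lweyl" where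
  "nabla \<omega> a z h L M =
     (\<Sum>s<length L. (-1) ^ s *
        (pdiff (L ! s) (\<lambda>z. a z h (omit s L) M) z
         - (\<Sum>t<length M. \<Sum>C\<in>UNIV.
              christoffel \<omega> z C (L ! s) (M ! t) * a z h (omit s L) (M[t := C]))))"

definition y_gen :: "'n idx \<Rightarrow> 'n lweyl" where
  "y_gen C z h L M = (if h = 0 \<and> L = [] \<and> M = [C] then 1 else 0)"

text \<open>\<open>curvature \<omega> z m i j k\<close> is \<open>R\<^sup>m\<^bsub>i\<bar>jk\<^esub>\<close>, defined by
  \<open>\<nabla>\<^sup>2(y\<^sup>m) = R\<^sup>m\<^bsub>i\<bar>jk\<^esub> dz\<^sup>i \<and> d\<bar>z\<^sup>j \<otimes> y\<^sup>k\<close>.\<close>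

definition curvature :: "'n::finite lform \<Rightarrow> complex ^ 'n \<Rightarrow> 'n \<Rightarrow> 'n \<Rightarrow> 'n \<Rightarrow> 'n \<Rightarrow> complex" where
  "curvature \<omega> z m i j k = nabla \<omega> (nabla \<omega> (y_gen (Inl m))) z 0 [Inl i, Inr j] [Inl k]"

definition curvature_low :: "'n::finite lform \<Rightarrow> complex ^ 'n \<Rightarrow> 'n \<Rightarrow> 'n \<Rightarrow> 'n \<Rightarrow> 'n \<Rightarrow> complex" where
  "curvature_low \<omega> z i j k l = (\<Sum>m\<in>UNIV. curvature \<omega> z m i j k * herm \<omega> z m l)"

text \<open>The components of \<open>dz\<^sup>i \<and> d\<bar>z\<^sup>j\<close> and of \<open>y\<^sup>k\<bar>y\<^sup>l\<close>.\<close>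

definition dz_dzbar :: "'n \<Rightarrow> 'n \<Rightarrow> 'n idx list \<Rightarrow> complex" where
  "dz_dzbar i j L = (if L = [Inl i, Inr j] then 1 else if L = [Inr j, Inl i] then -1 else 0)"

definition y_ybar :: "'n \<Rightarrow> 'n \<Rightarrow> 'n idx list \<Rightarrow> complex" where
  "y_ybar k l M = (if M = [Inl k, Inr l] \<or> M = [Inr l, Inl k] then 1 else 0)"

definition R_nabla :: "'n::finite lform \<Rightarrow> 'n lweyl" where
  "R_nabla \<omega> z h L M =
     (if h = 0 then
        \<Sum>i\<in>UNIV. \<Sum>j\<in>UNIV. \<Sum>k\<in>UNIV. \<Sum>l\<in>UNIV.
          \<i> * curvature_low \<omega> z i j k l * dz_dzbar i j L * y_ybar k l M
      else 0)"


section \<open>Operators on Weyl forms\<close>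

definition delta :: "'n lweyl \<Rightarrow> 'n lweyl" where
  "delta a z h L M = (\<Sum>s<length L. (-1) ^ s * a z h (omit s L) (L ! s # M))"

fun is_hol :: "'n idx \<Rightarrow> bool" where
  "is_hol (Inl i) = True"
| "is_hol (Inr j) = False"

definition hol_degree :: "'n idx list \<Rightarrow> nat" where
  "hol_degree L = length (filter is_hol L)"

text \<open>Division of each component by \<open>p\<^sub>1 + p\<^sub>2\<close>; division by zero gives zero.\<close>

definition normalize_hol :: "'n lweyl \<Rightarrow> 'n lweyl" where
  "normalize_hol a z h L M = a z h L M / of_nat (hol_degree L + hol_degree M)"

definition interior_mult :: "'n idx \<Rightarrow> 'n lweyl \<Rightarrow> 'n lweyl" where
  "interior_mult P a z h L M = a z h (P # L) M"

definition y_mult :: "'n idx \<Rightarrow> 'n lweyl \<Rightarrow> 'n lweyl" where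
  "y_mult P a z h L M = (\<Sum>t<length M. if M ! t = P then a z h L (omit t M) else 0)"

definition delta10_inv :: "'n::finite lweyl \<Rightarrow> 'n lweyl" where
  "delta10_inv a z h L M =
     (\<Sum>k\<in>UNIV. y_mult (Inl k) (interior_mult (Inl k) (normalize_hol a)) z h L M)"

definition pi0 :: "'n lweyl \<Rightarrow> 'n lweyl" where
  "pi0 a z h L M = (if hol_degree L = 0 \<and> hol_degree M = 0 then a z h L M else 0)"

text \<open>The sign of the shuffle that moves the positions in \<open>S\<close> to the front.\<close>

definition shuffle_sign :: "nat \<Rightarrow> nat set \<Rightarrow> complex" where
  "shuffle_sign p S = (-1) ^ card {(i, j). i < j \<and> j < p \<and> i \<notin> S \<and> j \<in> S}"

text \<open>The graded commutative product of Weyl forms: wedge product of the form parts, and Leibniz rule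
  for the Taylor coefficients.\<close>

definition weyl_mult :: "'n lweyl \<Rightarrow> 'n lweyl \<Rightarrow> 'n lweyl" where
  "weyl_mult a b z h L M =
     (\<Sum>h'\<le>h. \<Sum>S\<in>Pow {..<length L}. \<Sum>T\<in>Pow {..<length M}.
        shuffle_sign (length L) S * a z h' (nths L S) (nths M T)
          * b z (h - h') (nths L ({..<length L} - S)) (nths M ({..<length M} - T)))"

text \<open>Iterated derivative in the fibre variables \<open>y\<^sup>P\<close>, for \<open>P\<close> ranging over the list \<open>Ps\<close>.\<close>

definition y_deriv :: "'n idx list \<Rightarrow> 'n lweyl \<Rightarrow> 'n lweyl" where
  "y_deriv Ps a z h L M = a z h L (Ps @ M)"

definition wick :: "'n::finite lform \<Rightarrow> 'n lweyl \<Rightarrow> 'n lweyl \<Rightarrow> 'n lweyl" where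
  "wick \<omega> a b z h L M =
     (\<Sum>r\<le>h. 1 / fact r *
        (\<Sum>is | length is = r. \<Sum>js | length js = r.
           (\<Prod>s<r. omega_inv \<omega> z (is ! s) (js ! s)) *
           weyl_mult (y_deriv (map Inl is) a) (y_deriv (map Inr js) b) z (h - r) L M))"

text \<open>Multiplication by \<open>1/\<hbar>\<close>. It is only applied to \<open>I \<star> I\<close> for a 1-form \<open>I\<close>, which is divisible by
  \<open>\<hbar>\<close> by the lemma \<open>wick_self_hbar0\<close> below.\<close>

definition hbar_div :: "'n lweyl \<Rightarrow> 'n lweyl" where
  "hbar_div a z h L M = a z (Suc h) L M"

lemma wick_self_hbar0:
  assumes "\<And>L M. length L \<noteq> 1 \<Longrightarrow> a z 0 L M = 0"
  shows "wick \<omega> a a z 0 L M = 0"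
proof -
  have *: "weyl_mult a a z 0 L M = 0"
  proof (cases "length L = 2")
    case False
    have "a z 0 (nths L S) N * a z 0 (nths L ({..<length L} - S)) N' = 0"
      if "S \<in> Pow {..<length L}" for S N N'
    proof -
      have sub: "S \<subseteq> {..<length L}" and fin: "finite S"
        using that finite_subset by auto
      have "{i. i < length L \<and> i \<in> S} = S"
        using sub by auto
      moreover have "{i. i < length L \<and> i \<in> {..<length L} - S} = {..<length L} - S"
        by auto
      moreover have "card ({..<length L} - S) = length L - card S"
        using card_Diff_subset[OF fin sub] by simp
      ultimately have "length (nths L S) = card S"
        and "length (nths L ({..<length L} - S)) = length L - card S"
        unfolding length_nths by presburger+
      moreover have "card S \<le> length L"
        using that card_mono[of "{..<length L}" S] by auto
      ultimately have "length (nths L S) \<noteq> 1 \<or> length (nths L ({..<length L} - S)) \<noteq> 1"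
        using False by auto
      thus ?thesis using assms by auto
    qed
    thus ?thesis unfolding weyl_mult_def by (auto simp: mult.assoc intro!: sum.neutral)
  next
    case True
    then obtain P Q where L: "L = [P, Q]" 
      by (metis One_nat_def Suc_1 length_0_conv length_Suc_conv)
    have pw: "Pow {..<length L} = {{}, {0}, {1}, {0, 1}}"
      by (auto simp: L lessThan_Suc Pow_insert)
    have "{(i::nat, j). i < j \<and> j < 2 \<and> i \<notin> {0} \<and> j \<in> {0}} = {}"
      by auto
    hence s0: "shuffle_sign (length L) {0} = 1"
      unfolding shuffle_sign_def True by (simp only: card.empty power_0)
    have "{(i::nat, j). i < j \<and> j < 2 \<and> i \<notin> {1} \<and> j \<in> {1}} = {(0, 1)}"
      by auto
    hence s1: "shuffle_sign (length L) {1} = -1"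
      unfolding shuffle_sign_def True by (simp only:) simp
    have d0: "{..<length L} - {0} = {1}" and d1: "{..<length L} - {1} = {0}"
      by (auto simp: L)
    have n0: "nths L {0} = [P]" and n1: "nths L {1} = [Q]"
      by (auto simp: L nths_Cons)
    have ne: "nths L {} = []"
      by simp
    have nf: "{..<length L} - {0, 1} = {}"
      by (auto simp: L)
    define G where "G = (\<lambda>P Q. \<Sum>T\<in>Pow {..<length M}.
      a z 0 [P] (nths M T) * a z 0 [Q] (nths M ({..<length M} - T)))"
    define F where "F = (\<lambda>S. \<Sum>T\<in>Pow {..<length M}.
        shuffle_sign (length L) S * a z 0 (nths L S) (nths M T)
          * a z 0 (nths L ({..<length L} - S)) (nths M ({..<length M} - T)))"
    have G: "G Q P = G P Q"
      unfolding G_def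
      by (rule sum.reindex_bij_witness[of _ "\<lambda>T. {..<length M} - T" "\<lambda>T. {..<length M} - T"])
         (auto simp: double_diff mult.commute)
    have "F {} = 0" and "F {0, 1} = 0"
      unfolding F_def nf ne by (simp_all add: assms)
    moreover have "F {0} = G P Q"
      unfolding F_def G_def d0 s0 n0 n1 by simp
    moreover have "F {1} = - G Q P"
      unfolding F_def G_def d1 s1 n0 n1 by (simp add: sum_negf)
    moreover have "weyl_mult a a z 0 L M = sum F {{}, {0}, {1}, {0, 1}}"
      unfolding weyl_mult_def F_def pw[symmetric] by simp
    moreover have "sum F {{}, {0}, {1}, {0, 1}} = F {} + F {0} + F {1} + F {0, 1}"
    proof -
      have "{} \<noteq> {0::nat}" "{} \<noteq> {1::nat}" "{0} \<noteq> {1::nat}" "{} \<noteq> {0, 1::nat}"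
        "{0} \<noteq> {0, 1::nat}" "{1} \<noteq> {0, 1::nat}"
        by auto
      thus ?thesis
        by (simp add: add.assoc del: One_nat_def)
    qed
    ultimately show ?thesis
      using G by simp
  qed
  have "y_deriv [] a = a" by (intro ext) (simp add: y_deriv_def)
  thus ?thesis using * by (simp add: wick_def)
qed

definition fedosov_equation ::
  "('a, 'n::finite) chart set \<Rightarrow> ('a, 'n) form \<Rightarrow> ('a, 'n) weyl \<Rightarrow> ('a, 'n) weyl \<Rightarrow> bool" where
  "fedosov_equation A \<omega> \<alpha> I \<longleftrightarrow>
     (\<forall>c\<in>A. \<forall>z\<in>chart_image c. \<forall>h L M.
        nabla (\<omega> c) (I c) z h L M - delta (I c) z h L M
        + hbar_div (wick (\<omega> c) (I c) (I c)) z h L M + R_nabla (\<omega> c) z h L M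
        = \<alpha> c z h L M)"

definition vanishes :: "('a, 'n::finite) chart set \<Rightarrow> ('a, 'n) weyl \<Rightarrow> bool" where
  "vanishes A a \<longleftrightarrow> (\<forall>c\<in>A. \<forall>z\<in>chart_image c. \<forall>h L M. a c z h L M = 0)"

end

theory Submission
  imports Defs
begin

text \<open>Give \<open>\<hbar>\<close> and each \<open>y\<^sup>i\<close> the weight one, and \<open>\<bar>y\<^sup>j\<close>, \<open>dz\<^sup>i\<close>, \<open>d\<bar>z\<^sup>j\<close> the weight zero. The term of
  order \<open>\<hbar>\<^sup>r\<close> in the Wick product removes exactly \<open>r\<close> holomorphic variables, so the product is
  homogeneous, and the division by \<open>\<hbar>\<close> lowers the weight by one. The part \<open>\<delta>\<^sup>1\<^sup>,\<^sup>0\<close> of \<open>\<delta>\<close> lowers the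
  weight by one, and \<open>\<delta>\<^sup>0\<^sup>,\<^sup>1\<close> preserves it. Nor does \<open>\<nabla>\<close> lower it: by the Kaehler condition
  it never turns a \<open>y\<^sup>i\<close> into a \<open>\<bar>y\<^sup>j\<close> (\<open>christoffel_mixed_zero\<close>).

  The two normalizations force every term of a solution to contain some \<open>y\<^sup>i\<close>, hence to have positive
  weight (\<open>normalized_hol_degree_zero\<close>). Let two solutions agree in all weights below \<open>n\<close>, and compare
  their Fedosov equations in the weight \<open>n - 1\<close>. The connection terms agree. A component of
  \<open>I \<star> I / \<hbar>\<close> is a sum of products of two components of \<open>I\<close> whose weights add up to \<open>n\<close>; either both
  weights are below \<open>n\<close>, or one of them is zero and the product vanishes. Hence the quadratic terms
  agree too (\<open>wick_agree\<close>). What remains is \<open>\<delta>\<^sup>1\<^sup>,\<^sup>0 D = 0\<close> for the weight \<open>n\<close> part \<open>D\<close> of the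
  difference. Together with \<open>(\<delta>\<^sup>1\<^sup>,\<^sup>0)\<^sup>-\<^sup>1 D = 0\<close> and \<open>\<pi>\<^sub>0 D = 0\<close>, the Hodge decomposition of \<open>\<delta>\<^sup>1\<^sup>,\<^sup>0\<close> gives
  \<open>D = 0\<close> (\<open>agree_next_weight\<close>). By induction on \<open>n\<close> the solutions coincide.\<close>

section \<open>Wirtinger derivatives\<close>

lemma frechet_derivative_cong_open:
  assumes "open S" "z \<in> S" "\<And>x. x \<in> S \<Longrightarrow> f x = g x"
  shows "frechet_derivative f (at z) = frechet_derivative g (at z)"
proof -
  have "(f has_derivative D) (at z) \<longleftrightarrow> (g has_derivative D) (at z)" for D
    using assms has_derivative_transform_within_open by metis
  thus ?thesis unfolding frechet_derivative_def by simp
qed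

lemma pdiff_cong_open:
  assumes "open S" "z \<in> S" "\<And>x. x \<in> S \<Longrightarrow> f x = g x"
  shows "pdiff P f z = pdiff P g z"
  using frechet_derivative_cong_open[OF assms] by (cases P) simp_all

lemma pdiff_const [simp]: "pdiff P (\<lambda>z. k) z = 0"
  by (cases P) simp_all

lemma pdiff_cmult:
  assumes "f differentiable at z"
  shows "pdiff P (\<lambda>z. k * f z) z = k * pdiff P f z"
proof -
  have "((\<lambda>z. k * f z) has_derivative (\<lambda>v. k * frechet_derivative f (at z) v)) (at z)"
    using assms by (intro has_derivative_mult_right) (simp add: frechet_derivative_works)
  hence "frechet_derivative (\<lambda>z. k * f z) (at z) = (\<lambda>v. k * frechet_derivative f (at z) v)"
    by (rule frechet_derivative_at[symmetric])
  thus ?thesis by (cases P) (simp_all add: algebra_simps)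
qed

section \<open>Kaehler metrics and their Christoffel symbols\<close>

lemma sum_idx:
  fixes f :: "'n::finite idx \<Rightarrow> 'b::comm_monoid_add"
  shows "(\<Sum>P\<in>UNIV. f P) = (\<Sum>a\<in>UNIV. f (Inl a)) + (\<Sum>b\<in>UNIV. f (Inr b))"
proof -
  have "(\<Sum>P\<in>UNIV. f P) = (\<Sum>P\<in>range Inl \<union> range Inr. f P)"
    by (simp add: UNIV_sum)
  also have "\<dots> = (\<Sum>P\<in>range Inl. f P) + (\<Sum>P\<in>range Inr. f P)"
    by (rule sum.union_disjoint) auto
  also have "\<dots> = (\<Sum>a\<in>UNIV. f (Inl a)) + (\<Sum>b\<in>UNIV. f (Inr b))"
    by (simp add: sum.reindex)
  finally show ?thesis .
qed

definition positive_definite :: "('n::finite \<Rightarrow> 'n \<Rightarrow> complex) \<Rightarrow> bool" where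
  "positive_definite g \<longleftrightarrow>
     (\<forall>v::complex^'n. v \<noteq> 0 \<longrightarrow> 0 < Re (\<Sum>a\<in>UNIV. \<Sum>b\<in>UNIV. g a b * v $ a * cnj (v $ b)))"

lemma positive_definite_left_kernel:
  fixes g :: "'n::finite \<Rightarrow> 'n \<Rightarrow> complex"
  assumes "positive_definite g" "\<And>b. (\<Sum>a\<in>UNIV. g a b * u a) = 0"
  shows "u a = 0"
proof (rule ccontr)
  assume "u a \<noteq> 0"
  define v :: "complex^'n" where "v = (\<chi> a. u a)"
  have "v \<noteq> 0" using \<open>u a \<noteq> 0\<close> by (auto simp: v_def vec_eq_iff)
  have "(\<Sum>a\<in>UNIV. \<Sum>b\<in>UNIV. g a b * v $ a * cnj (v $ b))
      = (\<Sum>b\<in>UNIV. (\<Sum>a\<in>UNIV. g a b * u a) * cnj (u b))"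
    by (subst sum.swap) (simp add: v_def sum_distrib_right)
  also have "\<dots> = 0" by (simp add: assms(2))
  finally have "Re (\<Sum>a\<in>UNIV. \<Sum>b\<in>UNIV. g a b * v $ a * cnj (v $ b)) = 0"
    by (simp only: zero_complex.sel)
  moreover have "0 < Re (\<Sum>a\<in>UNIV. \<Sum>b\<in>UNIV. g a b * v $ a * cnj (v $ b))"
    using assms(1) \<open>v \<noteq> 0\<close> unfolding positive_definite_def by blast
  ultimately show False by (simp only: less_irrefl)
qed

lemma positive_definite_right_kernel:
  fixes g :: "'n::finite \<Rightarrow> 'n \<Rightarrow> complex"
  assumes "positive_definite g" "\<And>a. (\<Sum>b\<in>UNIV. g a b * u b) = 0"
  shows "u b = 0"
proof (rule ccontr)
  assume "u b \<noteq> 0"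
  define v :: "complex^'n" where "v = (\<chi> a. cnj (u a))"
  have "v \<noteq> 0" using \<open>u b \<noteq> 0\<close> by (auto simp: v_def vec_eq_iff)
  have "(\<Sum>a\<in>UNIV. \<Sum>b\<in>UNIV. g a b * v $ a * cnj (v $ b))
      = (\<Sum>a\<in>UNIV. (\<Sum>b\<in>UNIV. g a b * u b) * cnj (u a))"
    by (simp add: v_def sum_distrib_right sum_distrib_left mult_ac)
  also have "\<dots> = 0" by (simp add: assms(2))
  finally have "Re (\<Sum>a\<in>UNIV. \<Sum>b\<in>UNIV. g a b * v $ a * cnj (v $ b)) = 0"
    by (simp only: zero_complex.sel)
  moreover have "0 < Re (\<Sum>a\<in>UNIV. \<Sum>b\<in>UNIV. g a b * v $ a * cnj (v $ b))"
    using assms(1) \<open>v \<noteq> 0\<close> unfolding positive_definite_def by blast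
  ultimately show False by (simp only: less_irrefl)
qed

lemma metric_invertible:
  fixes \<omega> :: "'n::finite lform"
  assumes "positive_definite (herm \<omega> z)"
  shows "invertible (\<chi> E F. metric \<omega> z E F)"
proof -
  have "x = 0" if "(\<chi> E F. metric \<omega> z E F) *v x = 0" for x :: "complex ^ ('n idx)"
  proof -
    have row: "(\<Sum>F\<in>UNIV. metric \<omega> z E F * x $ F) = 0" for E
      using that by (simp add: vec_eq_iff matrix_vector_mult_def)
    have "x $ Inr b = 0" for b
      using positive_definite_right_kernel[OF assms, of "\<lambda>b. x $ Inr b"] row[of "Inl _"]
      by (simp add: sum_idx)
    moreover have "x $ Inl a = 0" for a
      using positive_definite_left_kernel[OF assms, of "\<lambda>a. x $ Inl a"] row[of "Inr _"]
      by (simp add: sum_idx)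
    ultimately show "x = 0"
      unfolding vec_eq_iff by (metis obj_sumE zero_index)
  qed
  thus ?thesis
    by (simp add: invertible_left_inverse matrix_left_invertible_ker)
qed

text \<open>The metric pairs only directions of opposite type; hence so does its inverse.\<close>

lemma metric_inverse_hol_block_zero:
  fixes \<omega> :: "'n::finite lform"
  assumes "positive_definite (herm \<omega> z)"
  shows "matrix_inv (\<chi> E F. metric \<omega> z E F) $ Inl c $ Inl d = 0"
proof -
  define G where "G = (\<chi> E F. metric \<omega> z E F)"
  have "G ** matrix_inv G = mat 1"
    using metric_invertible[OF assms] unfolding G_def matrix_inv_def invertible_def
    by (rule someI2_ex) simp
  hence "(G ** matrix_inv G) $ Inr b $ Inl d = 0" for b
    by (simp add: mat_def)
  hence "(\<Sum>a\<in>UNIV. herm \<omega> z a b * matrix_inv G $ Inl a $ Inl d) = 0" for b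
    by (simp add: matrix_matrix_mult_def sum_idx G_def)
  thus ?thesis
    using positive_definite_left_kernel[OF assms, of "\<lambda>a. matrix_inv G $ Inl a $ Inl d"]
    by (simp add: G_def)
qed

definition local_kaehler :: "(complex ^ 'n::finite) set \<Rightarrow> 'n lform \<Rightarrow> bool" where
  "local_kaehler S \<omega> \<longleftrightarrow> open S \<and>
     (\<forall>z\<in>S. positive_definite (herm \<omega> z) \<and> (\<forall>a b. \<omega> z [Inr a, Inr b] = 0) \<and>
        (\<forall>L. (\<lambda>z. \<omega> z L) differentiable at z) \<and> (\<forall>L. ext_d \<omega> z L = 0))"

lemma kaehler_manifold_local:
  fixes A :: "('a, 'n::finite) chart set"
  assumes "kaehler_manifold X A \<omega>" "c \<in> A"
  shows "local_kaehler (chart_image c) (\<omega> c)"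
proof -
  have "is_chart X c"
    using assms by (auto simp: kaehler_manifold_def complex_manifold_def)
  hence op: "open (chart_image c)" by (simp add: is_chart_def)
  have "(\<lambda>c z L M. if M = [] then \<omega> c z L else 0) \<in> sym_forms A 2"
    using assms by (simp add: kaehler_manifold_def diff_forms_def)
  hence "\<forall>c\<in>A. \<forall>L M. smooth_on (chart_image c) (\<lambda>z. if M = ([] :: 'n idx list) then \<omega> c z L else 0)"
    unfolding sym_forms_def mem_Collect_eq by (elim conjE)
  hence "\<forall>M. smooth_on (chart_image c) (\<lambda>z. if M = ([] :: 'n idx list) then \<omega> c z L else 0)" for L
    using assms(2) by blast
  hence "smooth_on (chart_image c) (\<lambda>z. if ([] :: 'n idx list) = [] then \<omega> c z L else 0)" for L
    by blast
  hence "Ck_on (Suc 0) (chart_image c) (\<lambda>z. \<omega> c z L)" for L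
    by (simp add: smooth_on_def del: Ck_on.simps)
  hence "(\<lambda>z. \<omega> c z L) differentiable at z" if "z \<in> chart_image c" for z L
    using that by simp
  thus ?thesis
    using assms op unfolding local_kaehler_def kaehler_manifold_def closed_form_def
      positive_definite_def by blast
qed

text \<open>This is the component \<open>dz\<^sup>a \<and> d\<bar>z\<^sup>q \<and> d\<bar>z\<^sup>d\<close> of \<open>d\<omega> = 0\<close>.\<close>

lemma kaehler_metric_symmetry:
  assumes "local_kaehler S \<omega>" "z \<in> S"
  shows "pdiff (Inr q) (\<lambda>z. herm \<omega> z a d) z = pdiff (Inr d) (\<lambda>z. herm \<omega> z a q) z"
proof -
  have op: "open S" and diff: "\<And>L. (\<lambda>z. \<omega> z L) differentiable at z"
    and closed: "ext_d \<omega> z [Inl a, Inr q, Inr d] = 0"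
    and zero: "\<And>x. x \<in> S \<Longrightarrow> \<omega> x [Inr q, Inr d] = 0"
    using assms by (auto simp: local_kaehler_def)
  have "pdiff (Inl a) (\<lambda>z. \<omega> z [Inr q, Inr d]) z = 0"
    using pdiff_cong_open[OF op assms(2) zero, where P = "Inl a"] by (simp del: pdiff.simps)
  hence "pdiff (Inr q) (\<lambda>z. \<omega> z [Inl a, Inr d]) z = pdiff (Inr d) (\<lambda>z. \<omega> z [Inl a, Inr q]) z"
    using closed by (simp add: ext_d_def omit_def eval_nat_numeral del: pdiff.simps)
  thus ?thesis
    unfolding herm_def by (simp only: pdiff_cmult[OF diff])
qed

text \<open>Since \<open>\<nabla>y\<^sup>C = - \<Gamma>\<^sup>C\<^bsub>PQ\<^esub> dx\<^sup>P \<otimes> y\<^sup>Q\<close>, these are the coefficients by which \<open>\<nabla>\<close> could replace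
  a \<open>y\<^sup>c\<close> by a \<open>\<bar>y\<^sup>q\<close>. Only \<open>D = \<bar>d\<close> contributes to the sum that defines them. For such a \<open>D\<close> and
  \<open>P = a\<close>, the two metric derivatives that remain cancel by closedness; for \<open>P = \<bar>a\<close>, all three
  vanish by type.\<close>

lemma christoffel_mixed_zero:
  assumes "local_kaehler S \<omega>" "z \<in> S"
  shows "christoffel \<omega> z (Inl c) P (Inr q) = 0"
proof -
  have "positive_definite (herm \<omega> z)"
    using assms by (auto simp: local_kaehler_def)
  note inv = metric_inverse_hol_block_zero[OF this]
  have "pdiff P (\<lambda>z. metric \<omega> z (Inr q) (Inr d)) z + pdiff (Inr q) (\<lambda>z. metric \<omega> z P (Inr d)) z
      - pdiff (Inr d) (\<lambda>z. metric \<omega> z P (Inr q)) z = 0" for d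
    using kaehler_metric_symmetry[OF assms, of q _ d] by (cases P) (simp_all del: pdiff.simps)
  thus ?thesis
    unfolding christoffel_def sum_idx inv by (simp del: pdiff.simps)
qed

section \<open>Weights\<close>

lemma hol_degree_simps [simp]:
  "hol_degree [] = 0"
  "hol_degree (Inl i # M) = Suc (hol_degree M)"
  "hol_degree (Inr j # M) = hol_degree M"
  "hol_degree (M @ N) = hol_degree M + hol_degree N"
  "hol_degree (map Inl is) = length is"
  "hol_degree (map Inr js) = 0"
  by (simp_all add: hol_degree_def comp_def filter_map)

lemma hol_degree_mset: "hol_degree M = size (filter_mset is_hol (mset M))"
  by (simp add: hol_degree_def flip: mset_filter)

lemma hol_degree_cong: "mset M = mset N \<Longrightarrow> hol_degree M = hol_degree N"
  by (simp add: hol_degree_mset)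

lemma mset_nths_complement:
  "mset (nths M T) + mset (nths M ({..<length M} - T)) = mset M"
proof (induction M arbitrary: T)
  case Nil
  show ?case by simp
next
  case (Cons P M)
  have eq: "{j. j < length M \<and> Suc j \<notin> T} = {..<length M} - {j. Suc j \<in> T}"
    by auto
  show ?case
    using Cons.IH[of "{j. Suc j \<in> T}"] by (auto simp: nths_Cons eq)
qed

lemma hol_degree_nths_complement:
  "hol_degree (nths M T) + hol_degree (nths M ({..<length M} - T)) = hol_degree M"
proof -
  have "hol_degree M
      = size (filter_mset is_hol (mset (nths M T) + mset (nths M ({..<length M} - T))))"
    by (simp only: mset_nths_complement hol_degree_mset)
  thus ?thesis by (simp add: hol_degree_mset)
qed

lemma mset_omit:
  assumes "t < length M"
  shows "mset (M ! t # omit t M) = mset M"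
proof -
  have "M = take t M @ M ! t # drop (Suc t) M"
    using assms by (rule id_take_nth_drop)
  hence "mset M = mset (take t M @ M ! t # drop (Suc t) M)"
    by (rule arg_cong)
  thus ?thesis by (simp add: omit_def)
qed

lemma hol_degree_update_le:
  assumes "t < length M" "is_hol C \<Longrightarrow> is_hol (M ! t)"
  shows "hol_degree (M[t := C]) \<le> hol_degree M"
proof -
  have "mset M = add_mset (M ! t) (mset M - {#M ! t#})"
    using assms(1) by simp
  hence "hol_degree M = size (filter_mset is_hol (add_mset (M ! t) (mset M - {#M ! t#})))"
    by (simp add: hol_degree_mset)
  moreover have "hol_degree (M[t := C]) = size (filter_mset is_hol (add_mset C (mset M - {#M ! t#})))"
    using assms(1) by (simp add: hol_degree_mset mset_update)
  ultimately show ?thesis using assms(2) by auto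
qed

definition agree_below :: "nat \<Rightarrow> (complex ^ 'n) set \<Rightarrow> 'n lweyl \<Rightarrow> 'n lweyl \<Rightarrow> bool" where
  "agree_below n S a b \<longleftrightarrow>
     (\<forall>z\<in>S. \<forall>h L M. h + hol_degree M < n \<longrightarrow> a z h L M = b z h L M)"

lemma agree_belowD:
  "agree_below n S a b \<Longrightarrow> z \<in> S \<Longrightarrow> h + hol_degree M < n \<Longrightarrow> a z h L M = b z h L M"
  by (simp add: agree_below_def)

text \<open>The derivative along the base only sees weights below \<open>n\<close>, because \<open>S\<close> is open and the two
  sections agree there on all of \<open>S\<close>, not just at \<open>z\<close>.\<close>

lemma nabla_agree:
  assumes K: "local_kaehler S \<omega>" and z: "z \<in> S" and ag: "agree_below n S a b"
    and w: "h + hol_degree M < n"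
  shows "nabla \<omega> a z h L M = nabla \<omega> b z h L M"
proof -
  have op: "open S" using K by (simp add: local_kaehler_def)
  have d: "pdiff P (\<lambda>z. a z h N M) z = pdiff P (\<lambda>z. b z h N M) z" for P N
    by (rule pdiff_cong_open[OF op z]) (rule agree_belowD[OF ag _ w])
  have g: "christoffel \<omega> z C P (M ! t) * a z h N (M[t := C])
      = christoffel \<omega> z C P (M ! t) * b z h N (M[t := C])" if "t < length M" for t C P N
  proof (cases "is_hol C \<and> \<not> is_hol (M ! t)")
    case True
    then obtain c q where "C = Inl c" "M ! t = Inr q"
      by (metis is_hol.simps obj_sumE)
    thus ?thesis using christoffel_mixed_zero[OF K z] by simp
  next
    case False
    hence "h + hol_degree (M[t := C]) < n"
      using hol_degree_update_le[OF that, of C] w by auto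
    thus ?thesis using agree_belowD[OF ag z] by simp
  qed
  have "(\<Sum>t<length M. \<Sum>C\<in>UNIV. christoffel \<omega> z C P (M ! t) * a z h N (M[t := C]))
      = (\<Sum>t<length M. \<Sum>C\<in>UNIV. christoffel \<omega> z C P (M ! t) * b z h N (M[t := C]))" for P N
    using g by (intro sum.cong refl) simp
  thus ?thesis unfolding nabla_def by (simp only: d)
qed

text \<open>The weight \<open>n\<close>, for which \<open>a\<close> and \<open>b\<close> may differ, is included in the conclusion: if one factor of
  a product has weight \<open>n\<close>, then the other has weight zero, and the product vanishes.\<close>

lemma wick_agree:
  assumes z: "z \<in> S" and ag: "agree_below n S a b"
    and a0: "\<And>h L M. hol_degree M = 0 \<Longrightarrow> a z h L M = 0"
    and b0: "\<And>h L M. hol_degree M = 0 \<Longrightarrow> b z h L M = 0"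
    and w: "h + hol_degree M \<le> n"
  shows "wick \<omega> a a z h L M = wick \<omega> b b z h L M"
proof -
  have prod: "a z k K N * a z k' K' N' = b z k K N * b z k' K' N'"
    if "k + hol_degree N + (k' + hol_degree N') \<le> n" for k k' K K' N N'
  proof (cases "hol_degree N = 0 \<or> hol_degree N' = 0")
    case True
    thus ?thesis using a0 b0 by auto
  next
    case False
    hence "k + hol_degree N < n" "k' + hol_degree N' < n" using that by auto
    thus ?thesis using agree_belowD[OF ag z] by simp
  qed
  have "weyl_mult (y_deriv (map Inl is) a) (y_deriv (map Inr js) a) z (h - r) L M
      = weyl_mult (y_deriv (map Inl is) b) (y_deriv (map Inr js) b) z (h - r) L M"
    if r: "r \<le> h" and len: "length is = r" for r "is" js
  proof -
    have "a z h' K (map Inl is @ nths M T)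
          * a z (h - r - h') K' (map Inr js @ nths M ({..<length M} - T))
        = b z h' K (map Inl is @ nths M T)
          * b z (h - r - h') K' (map Inr js @ nths M ({..<length M} - T))"
      if "h' \<le> h - r" for h' T K K'
      using prod hol_degree_nths_complement[of M T] that r len w by simp
    thus ?thesis
      unfolding weyl_mult_def y_deriv_def by (simp add: mult.assoc)
  qed
  thus ?thesis unfolding wick_def by simp
qed

section \<open>The normalization conditions\<close>

text \<open>Up to the nonzero factor of the normalization, \<open>(\<delta>\<^sup>1\<^sup>,\<^sup>0)\<^sup>-\<^sup>1\<close> maps a 1-form \<open>a\<close> to \<open>y\<^sup>k a\<^sub>k\<close>. The
  derivatives of this product are the sums over the holomorphic entries of \<open>N\<close>.\<close>

lemma delta10_inv_one_form:
  assumes "delta10_inv a z h [] N = 0"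
  shows "(\<Sum>t<length N. if is_hol (N ! t) then a z h [N ! t] (omit t N) else 0) = 0"
proof -
  have deg: "Suc (hol_degree (omit t N)) = hol_degree N" if "t < length N" "is_hol (N ! t)" for t
    using hol_degree_cong[OF mset_omit[OF that(1)]] that(2) by (cases "N ! t") auto
  have "delta10_inv a z h [] N
      = (\<Sum>t<length N. \<Sum>k\<in>UNIV. if N ! t = Inl k
          then a z h [Inl k] (omit t N) / of_nat (Suc (hol_degree (omit t N))) else 0)"
    unfolding delta10_inv_def y_mult_def interior_mult_def normalize_hol_def
    by (subst sum.swap) (simp cong: if_cong)
  also have "\<dots> = (\<Sum>t<length N. (if is_hol (N ! t) then a z h [N ! t] (omit t N) else 0)
      / of_nat (hol_degree N))"
  proof (rule sum.cong[OF refl])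
    fix t assume t: "t \<in> {..<length N}"
    show "(\<Sum>k\<in>UNIV. if N ! t = Inl k
        then a z h [Inl k] (omit t N) / of_nat (Suc (hol_degree (omit t N))) else 0)
      = (if is_hol (N ! t) then a z h [N ! t] (omit t N) else 0) / of_nat (hol_degree N)"
      using deg[of t] t by (cases "N ! t") (simp_all del: of_nat_Suc)
  qed
  also have "\<dots> = (\<Sum>t<length N. if is_hol (N ! t) then a z h [N ! t] (omit t N) else 0)
      / of_nat (hol_degree N)"
    by (simp add: sum_divide_distrib)
  finally have *: "(\<Sum>t<length N. if is_hol (N ! t) then a z h [N ! t] (omit t N) else 0)
      / of_nat (hol_degree N) = 0"
    using assms by simp
  show ?thesis
  proof (cases "hol_degree N = 0")
    case True
    hence "\<not> is_hol (N ! t)" if "t < length N" for t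
      using that by (auto simp: hol_degree_def filter_empty_conv)
    thus ?thesis by simp
  next
    case False
    thus ?thesis using * by simp
  qed
qed

definition normalized_one_form :: "(complex ^ 'n::finite) set \<Rightarrow> 'n lweyl \<Rightarrow> bool" where
  "normalized_one_form S a \<longleftrightarrow> (\<forall>z\<in>S. \<forall>h L M.
     (length L \<noteq> 1 \<longrightarrow> a z h L M = 0) \<and> symmetric (a z h L) \<and>
     delta10_inv a z h L M = 0 \<and> pi0 a z h L M = 0)"

lemma symmetricD: "symmetric f \<Longrightarrow> mset M = mset N \<Longrightarrow> f M = f N"
  unfolding symmetric_def by blast

lemma normalized_hol_degree_zero:
  assumes nf: "normalized_one_form S a" and z: "z \<in> S" and M: "hol_degree M = 0"
  shows "a z h L M = 0"
proof (cases "length L = 1")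
  case False
  thus ?thesis using nf z by (simp add: normalized_one_form_def)
next
  case True
  then obtain P where L: "L = [P]" by (metis One_nat_def length_0_conv length_Suc_conv)
  show ?thesis
  proof (cases P)
    case (Inl k)
    have anti: "\<not> is_hol (M ! t)" if "t < length M" for t
      using M that by (auto simp: hol_degree_def filter_empty_conv)
    have "delta10_inv a z h [] (Inl k # M) = 0"
      using nf z by (simp add: normalized_one_form_def)
    from delta10_inv_one_form[OF this] show ?thesis
      using anti by (simp add: sum.lessThan_Suc_shift omit_def L Inl del: sum.lessThan_Suc)
  next
    case (Inr j)
    have "pi0 a z h L M = 0" using nf z by (simp add: normalized_one_form_def)
    thus ?thesis using M by (simp add: pi0_def L Inr)
  qed
qed

section \<open>Uniqueness\<close>

lemma delta_two: "delta a z h [P, Q] M = a z h [Q] (P # M) - a z h [P] (Q # M)"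
  by (simp add: delta_def omit_def eval_nat_numeral)

text \<open>The Hodge argument. Let \<open>D\<close> be the difference in the weight \<open>n\<close>. Equality of \<open>\<delta>\<close> on
  \<open>dz\<^sup>k \<and> d\<bar>z\<^sup>j\<close> expresses a term of the \<open>d\<bar>z\<^sup>j\<close> part that contains \<open>y\<^sup>k\<close> by a term of lower weight, which
  vanishes. Equality of \<open>\<delta>\<close> on \<open>dz\<^sup>k \<and> dz\<^sup>l\<close> makes \<open>D\<^sub>k\<^sub>,\<^sub>l\<^sub>\<dots>\<close> symmetric in the form index \<open>k\<close> and the index \<open>l\<close> of
  any \<open>y\<^sup>l\<close>, so that all terms of \<open>y\<^sup>k D\<^sub>k = 0\<close> coincide and each of them vanishes.\<close>

lemma agree_next_weight:
  fixes a b :: "'n::finite lweyl"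
  assumes a: "normalized_one_form S a" and b: "normalized_one_form S b"
    and ag: "agree_below n S a b"
    and del: "\<And>z h L M. z \<in> S \<Longrightarrow> Suc (h + hol_degree M) = n \<Longrightarrow> delta a z h L M = delta b z h L M"
  shows "agree_below (Suc n) S a b"
  unfolding agree_below_def
proof (intro ballI allI impI)
  fix z h L and M :: "'n idx list" assume z: "z \<in> S" and "h + hol_degree M < Suc n"
  show "a z h L M = b z h L M"
  proof (cases "h + hol_degree M < n \<or> hol_degree M = 0 \<or> length L \<noteq> 1")
    case True
    thus ?thesis
      using agree_belowD[OF ag z] normalized_hol_degree_zero[OF a z]
        normalized_hol_degree_zero[OF b z] a b z
      by (auto simp: normalized_one_form_def)
  next
    case False
    hence n: "h + hol_degree M = n" and pos: "hol_degree M \<noteq> 0"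
      using \<open>h + hol_degree M < Suc n\<close> by auto
    obtain P where L: "L = [P]"
      using False by (metis One_nat_def length_0_conv length_Suc_conv)
    define D where "D = (\<lambda>P N. a z h [P] N - b z h [P] N)"
    have sym: "D P N = D P N'" if "mset N = mset N'" for P N N'
      using a b z symmetricD[OF _ that] unfolding D_def normalized_one_form_def by metis
    have closed: "D Q (P # N) = D P (Q # N)" if "Suc (h + hol_degree N) = n" for P Q N
      using del[OF z that, of "[P, Q]"] unfolding D_def delta_two by (simp add: algebra_simps)
    have "D P M = 0"
    proof (cases P)
      case (Inr j)
      have "\<exists>R\<in>set M. is_hol R"
        using pos by (auto simp: hol_degree_def filter_empty_conv)
      then obtain R t where t: "t < length M" "M ! t = R" "is_hol R"
        by (metis in_set_conv_nth)
      then obtain k where k: "M ! t = Inl k" by (metis is_hol.elims(2))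
      have m: "mset (Inl k # omit t M) = mset M"
        using mset_omit[OF t(1)] k by simp
      have w: "Suc (h + hol_degree (omit t M)) = n"
        using hol_degree_cong[OF m] n by simp
      have "D P M = D P (Inl k # omit t M)" by (rule sym) (simp only: m)
      also have "\<dots> = D (Inl k) (P # omit t M)" by (rule closed[OF w])
      also have "\<dots> = 0"
        using agree_belowD[OF ag z, of h "P # omit t M"] w by (simp add: D_def Inr)
      finally show ?thesis .
    next
      case (Inl k)
      define N where "N = P # M"
      have same: "D (N ! t) (omit t N) = D P M" if t: "t < length N" and hol: "is_hol (N ! t)" for t
      proof (cases t)
        case 0
        thus ?thesis by (simp add: N_def omit_def)
      next
        case (Suc s)
        hence s: "s < length M" using t by (simp add: N_def)
        have m: "mset (M ! s # omit s M) = mset M" by (rule mset_omit[OF s])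
        obtain l where l: "M ! s = Inl l"
          using hol Suc by (metis N_def is_hol.elims(2) nth_Cons_Suc)
        have w: "Suc (h + hol_degree (omit s M)) = n"
          using hol_degree_cong[OF m] n l by simp
        have "D (N ! t) (omit t N) = D (M ! s) (P # omit s M)"
          by (simp add: N_def Suc omit_def)
        also have "\<dots> = D P (M ! s # omit s M)" by (rule closed[OF w])
        also have "\<dots> = D P M" by (rule sym[OF m])
        finally show ?thesis .
      qed
      have "delta10_inv a z h [] N = 0" "delta10_inv b z h [] N = 0"
        using a b z by (simp_all add: normalized_one_form_def)
      note this[THEN delta10_inv_one_form]
      hence "0 = (\<Sum>t<length N. if is_hol (N ! t) then a z h [N ! t] (omit t N) else 0)
          - (\<Sum>t<length N. if is_hol (N ! t) then b z h [N ! t] (omit t N) else 0)"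
        by simp
      also have "\<dots> = (\<Sum>t<length N. if is_hol (N ! t) then D (N ! t) (omit t N) else 0)"
        unfolding D_def sum_subtractf[symmetric] by (intro sum.cong) auto
      also have "\<dots> = (\<Sum>t<length N. if is_hol (N ! t) then D P M else 0)"
        using same by (intro sum.cong) auto
      also have "\<dots> = of_nat (card {t\<in>{..<length N}. is_hol (N ! t)}) * D P M"
        by (simp add: sum.inter_filter[symmetric])
      finally have "of_nat (card {t\<in>{..<length N}. is_hol (N ! t)}) * D P M = 0" by simp
      moreover have "0 \<in> {t\<in>{..<length N}. is_hol (N ! t)}" by (simp add: N_def Inl)
      hence "card {t\<in>{..<length N}. is_hol (N ! t)} \<noteq> 0" by (subst card_eq_0_iff) auto
      ultimately show ?thesis by (simp only: mult_eq_0_iff of_nat_eq_0_iff) blast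
    qed
    thus ?thesis by (simp add: D_def L)
  qed
qed

lemma weyl_one_form_normalized:
  assumes "I \<in> weyl_forms A 1" "c \<in> A"
    and "vanishes A (\<lambda>c. delta10_inv (I c))" "vanishes A (\<lambda>c. pi0 (I c))"
  shows "normalized_one_form (chart_image c) (I c)"
proof -
  have S: "(\<lambda>c z L M. I c z h L M) \<in> sym_forms A 1" for h
    using assms(1) by (simp add: weyl_forms_def)
  have "I c z h L M = 0" if "length L \<noteq> 1" for z h L M
    using S[of h] that unfolding sym_forms_def by blast
  moreover have "symmetric (I c z h L)" if "z \<in> chart_image c" for z h L
    using S[of h] that assms(2) unfolding sym_forms_def by blast
  ultimately show ?thesis
    using assms by (auto simp: normalized_one_form_def vanishes_def)
qed

lemma fedosov_solutions_agree:
  fixes I J :: "('a, 'n::finite) weyl"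
  assumes K: "kaehler_manifold X A \<omega>" and c: "c \<in> A"
    and I: "fedosov_equation A \<omega> \<alpha> I" "normalized_one_form (chart_image c) (I c)"
    and J: "fedosov_equation A \<omega> \<alpha> J" "normalized_one_form (chart_image c) (J c)"
  shows "agree_below n (chart_image c) (I c) (J c)"
proof (induction n)
  case 0
  show ?case by (simp add: agree_below_def)
next
  case (Suc n)
  show ?case
  proof (rule agree_next_weight[OF I(2) J(2) Suc.IH])
    fix z h L and M :: "'n idx list" assume z: "z \<in> chart_image c" and w: "Suc (h + hol_degree M) = n"
    have "nabla (\<omega> c) (I c) z h L M = nabla (\<omega> c) (J c) z h L M"
      using w by (intro nabla_agree[OF kaehler_manifold_local[OF K c] z Suc.IH]) simp
    moreover have "hbar_div (wick (\<omega> c) (I c) (I c)) z h L M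
        = hbar_div (wick (\<omega> c) (J c) (J c)) z h L M"
      unfolding hbar_div_def using w
      by (intro wick_agree[OF z Suc.IH] normalized_hol_degree_zero[OF I(2) z]
          normalized_hol_degree_zero[OF J(2) z]) simp_all
    moreover have "nabla (\<omega> c) (I c) z h L M - delta (I c) z h L M
          + hbar_div (wick (\<omega> c) (I c) (I c)) z h L M + R_nabla (\<omega> c) z h L M
        = nabla (\<omega> c) (J c) z h L M - delta (J c) z h L M
          + hbar_div (wick (\<omega> c) (J c) (J c)) z h L M + R_nabla (\<omega> c) z h L M"
      using I(1) J(1) c z by (simp add: fedosov_equation_def)
    ultimately show "delta (I c) z h L M = delta (J c) z h L M" by simp
  qed
qed

theorem proposition2p22:
  fixes X :: "'a topology" and A :: "('a, 'n::finite) chart set"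
    and \<omega> :: "('a, 'n) form" and w :: "nat \<Rightarrow> ('a, 'n) form"
  assumes "kaehler_manifold X A \<omega>"
    and "\<And>k. k \<ge> 1 \<Longrightarrow> w k \<in> diff_forms A 2"
    and "\<And>k. k \<ge> 1 \<Longrightarrow> closed_form A (w k)"
  shows "\<exists>\<^sub>\<le>\<^sub>1 I. I \<in> weyl_forms A 1 \<and>
           fedosov_equation A \<omega> (formal_form w) I \<and>
           vanishes A (\<lambda>c. delta10_inv (I c)) \<and>
           vanishes A (\<lambda>c. pi0 (I c))"
proof (rule Uniq_I, elim conjE)
  fix I J
  assume I: "I \<in> weyl_forms A 1" "fedosov_equation A \<omega> (formal_form w) I"
      "vanishes A (\<lambda>c. delta10_inv (I c))" "vanishes A (\<lambda>c. pi0 (I c))"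
    and J: "J \<in> weyl_forms A 1" "fedosov_equation A \<omega> (formal_form w) J"
      "vanishes A (\<lambda>c. delta10_inv (J c))" "vanishes A (\<lambda>c. pi0 (J c))"
  have zero: "I' c z h L M = 0"
    if "I' \<in> weyl_forms A 1" "c \<notin> A \<or> z \<notin> chart_image c" for I' c z h L M
  proof -
    have "(\<lambda>c z L M. I' c z h L M) \<in> sym_forms A 1"
      using that(1) by (simp add: weyl_forms_def)
    thus ?thesis using that(2) unfolding sym_forms_def by blast
  qed
  have "I c z h L M = J c z h L M" for c z h L M
  proof (cases "c \<in> A \<and> z \<in> chart_image c")
    case True
    hence "agree_below (Suc (h + hol_degree M)) (chart_image c) (I c) (J c)"
      using I J by (intro fedosov_solutions_agree[OF assms(1)] weyl_one_form_normalized) auto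
    thus ?thesis using True by (intro agree_belowD) auto
  next
    case False
    thus ?thesis using zero[OF I(1)] zero[OF J(1)] by auto
  qed
  thus "I = J" by (intro ext)
qed

end
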